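(* Let $p$ be a prime number and let $\ell,m,s$ be non-negative integers such that $0<s<p$. Then $$\sum_{i\ge 0}(-1)^{m-i}\binom{m}{i}\binom{\ell+ip}{m+s-1}\equiv 0 \pmod{p^m},$$ and the quotient is an integer-valued polynomial function of $m$ of degree $s-1$; that is, for fixed $p,\ell,s$ there is a polynomial $Q\in\mathbb{Q}[x]$ of degree $s-1$, taking integer values at integers, such that for all integers $m\ge 0$ one has $$\sum_{i\ge 0}(-1)^{m-i}\binom{m}{i}\binom{\ell+ip}{m+s-1}=p^m Q(m).$$
   Context: $\binom{n}{k}$ is the usual binomial coefficient, equal to $0$ when $0\le n<k$; the sum is therefore finite. *)

theory Defs
  imports Complex_Main "HOL-Computational_Algebra.Computational_Algebra" "HOL-Number_Theory.Cong"
begin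

(* The sum over all i >= 0 is cut off at i = m, since "m choose i" vanishes for i > m; on this
   range the exponent m - i does not truncate. The lower index m + s - 1 is only meaningful
   for s > 0. *)
definition alt_binom_sum :: "nat \<Rightarrow> nat \<Rightarrow> nat \<Rightarrow> nat \<Rightarrow> int" where
  "alt_binom_sum p l s m =
     (\<Sum>i\<le>m. (-1) ^ (m - i) * int (m choose i) * int ((l + i * p) choose (m + s - 1)))"

end

theory Submission
  imports Defs
begin

text \<open>
  The sum is the coefficient of \<open>X ^ (m + s - 1)\<close> in \<open>(1 + X) ^ l * ((1 + X) ^ p - 1) ^ m\<close>.
  Over the rationals, \<open>(1 + X) ^ p - 1 = p * X * (1 + X * u)\<close> for a power series \<open>u\<close> whose
  coefficients below \<open>X ^ (p - 2)\<close> are integers, because \<open>p\<close> divides \<open>p choose k\<close> for \<open>0 < k < p\<close>.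
  Hence the sum is \<open>p ^ m\<close> times the coefficient of \<open>X ^ (s - 1)\<close> in \<open>(1 + X) ^ l * (1 + X * u) ^ m\<close>.
  Expanding the last power gives an integer combination of the binomial coefficients \<open>m choose j\<close>
  with \<open>j < s\<close>, where \<open>m choose (s - 1)\<close> has the coefficient \<open>((p - 1) / 2) ^ (s - 1) \<noteq> 0\<close>.
\<close>

definition gbinomial_poly :: "nat \<Rightarrow> 'a::field_char_0 poly" where
  "gbinomial_poly j = smult (1 / fact j) (\<Prod>i<j. [:- of_nat i, 1:])"

lemma poly_gbinomial_poly: "poly (gbinomial_poly j) x = x gchoose j"
  by (simp add: gbinomial_poly_def poly_prod gbinomial_prod_rev atLeast0LessThan)

lemma degree_gbinomial_poly: "degree (gbinomial_poly j) = j"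
  by (simp add: gbinomial_poly_def degree_prod_sum_eq)

lemma gbinomial_of_int_in_Ints: "(of_int x :: 'a::field_char_0) gchoose j \<in> \<int>"
  by (simp flip: of_int_gbinomial)

lemma fps_one_plus_X_power_nth:
  "((1 + fps_X) ^ n :: 'a::field_char_0 fps) $ k = of_nat (n choose k)"
  by (simp add: fps_binomial_of_nat[symmetric] binomial_gbinomial)

text \<open>Integrality is only required below a bound \<open>n\<close>, since a product coefficient
  involves no factor coefficients of higher index. The series used later is not integral
  throughout.\<close>

lemma fps_mult_nth_in_Ints:
  fixes f g :: "'a::ring_1 fps"
  assumes "\<And>k. k < n \<Longrightarrow> f $ k \<in> \<int>" "\<And>k. k < n \<Longrightarrow> g $ k \<in> \<int>" "k < n"
  shows "(f * g) $ k \<in> \<int>"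
  unfolding fps_mult_nth using assms by (intro Ints_sum Ints_mult) auto

lemma fps_power_nth_in_Ints:
  fixes f :: "'a::comm_ring_1 fps"
  assumes "\<And>k. k < n \<Longrightarrow> f $ k \<in> \<int>" "k < n"
  shows "(f ^ j) $ k \<in> \<int>"
  using assms(2)
proof (induction j arbitrary: k)
  case (Suc j)
  show ?case
    unfolding power_Suc using assms(1) Suc by (intro fps_mult_nth_in_Ints[of n]) auto
qed auto

text \<open>The series \<open>u\<close> of the overview. For prime \<open>p\<close> its coefficient
  at \<open>p - 2\<close> is \<open>1 / p\<close>, hence the rational coefficients.\<close>

definition prime_quot_series :: "nat \<Rightarrow> rat fps" where
  "prime_quot_series p = Abs_fps (\<lambda>k. of_nat (p choose (k + 2)) / of_nat p)"

lemma one_plus_X_power_minus_one: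
  assumes "p > 0"
  shows "(1 + fps_X) ^ p - 1 = of_nat p * (fps_X * (1 + fps_X * prime_quot_series p))"
proof (rule fps_ext)
  fix n :: nat
  consider "n = 0" | "n = 1" | k where "n = k + 2"
    by (metis One_nat_def add_2_eq_Suc' not0_implies_Suc)
  then show "((1 + fps_X) ^ p - 1) $ n
      = (of_nat p * (fps_X * (1 + fps_X * prime_quot_series p))) $ n"
    using assms
    by cases (auto simp: fps_one_plus_X_power_nth prime_quot_series_def
        simp flip: fps_of_nat)
qed

lemma prime_quot_series_nth_in_Ints:
  assumes "prime p" "k + 2 < p"
  shows "prime_quot_series p $ k \<in> \<int>"
proof -
  have "p dvd (p choose (k + 2))"
    using assms by (intro dvd_choose_prime) auto
  then obtain c where "p choose (k + 2) = p * c" by auto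
  then show ?thesis
    using assms prime_gt_0_nat[OF assms(1)] by (simp add: prime_quot_series_def)
qed

lemma prime_quot_series_nth_0: "p > 0 \<Longrightarrow> prime_quot_series p $ 0 = (of_nat p - 1) / 2"
  by (simp add: prime_quot_series_def binomial_gbinomial gbinomial_prod_rev numeral_2_eq_2)

text \<open>Expanding the \<open>m\<close>-th power by the binomial theorem gives an alternating
  combination of the powers \<open>(1 + fps_X) ^ (l + i * p)\<close>.\<close>

lemma of_int_alt_binom_sum:
  "(of_int (alt_binom_sum p l s m) :: rat)
     = ((1 + fps_X) ^ l * ((1 + fps_X) ^ p - 1) ^ m) $ (m + s - 1)"
proof -
  have "((1 + fps_X) ^ l * ((1 + fps_X) ^ p - 1) ^ m :: rat fps)
      = (1 + fps_X) ^ l * ((1 + fps_X) ^ p + (- 1)) ^ m"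
    by simp
  also have "\<dots> = (\<Sum>i\<le>m. fps_const ((- 1) ^ (m - i) * of_nat (m choose i))
      * (1 + fps_X) ^ (l + i * p))"
    unfolding binomial_ring[of "(1 + fps_X) ^ p"] sum_distrib_left
  proof (intro sum.cong refl)
    fix i
    have "(- 1) ^ (m - i) = fps_const ((- 1) ^ (m - i) :: rat)"
      by (simp flip: fps_const_power fps_const_neg)
    moreover have "(1 + fps_X :: rat fps) ^ (l + i * p) = (1 + fps_X) ^ l * ((1 + fps_X) ^ p) ^ i"
      by (simp add: power_add mult.commute[of i] flip: power_mult)
    ultimately show "(1 + fps_X) ^ l * (of_nat (m choose i) * ((1 + fps_X) ^ p) ^ i * (- 1) ^ (m - i))
        = fps_const ((- 1) ^ (m - i) * of_nat (m choose i)) * (1 + fps_X :: rat fps) ^ (l + i * p)"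
      by (simp only: fps_const_mult[symmetric] fps_of_nat mult_ac)
  qed
  finally show ?thesis
    by (simp add: alt_binom_sum_def fps_sum_nth fps_one_plus_X_power_nth)
qed

text \<open>The weight of \<open>m choose j\<close> in the quotient. Only \<open>j < s\<close>
  occurs, so the subtraction does not truncate.\<close>

definition quot_coeff :: "nat \<Rightarrow> nat \<Rightarrow> nat \<Rightarrow> nat \<Rightarrow> rat" where
  "quot_coeff p l s j = ((1 + fps_X) ^ l * prime_quot_series p ^ j) $ (s - 1 - j)"

text \<open>Pulling out \<open>p ^ m\<close> and \<open>X ^ m\<close> lowers the index from
  \<open>m + s - 1\<close> to \<open>s - 1\<close>, so the number of terms no longer depends on
  \<open>m\<close>.\<close>

lemma of_int_alt_binom_sum_expansion:
  assumes "p > 0" "s > 0"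
  shows "of_int (alt_binom_sum p l s m)
    = of_nat p ^ m * (\<Sum>j<s. quot_coeff p l s j * (of_nat m gchoose j))"
proof -
  let ?u = "prime_quot_series p" and ?b = "1 + fps_X :: rat fps"
  have summand: "(?b ^ l * (of_nat (m choose j) * (fps_X * ?u) ^ j)) $ (s - 1)
      = (if j < s then quot_coeff p l s j * (of_nat m gchoose j) else 0)" for j
  proof -
    have *: "?b ^ l * (of_nat (m choose j) * (fps_X * ?u) ^ j)
        = fps_const (of_nat (m choose j)) * (fps_X ^ j * (?b ^ l * ?u ^ j))"
      by (simp add: power_mult_distrib mult_ac flip: fps_of_nat)
    show ?thesis
      unfolding * fps_mult_left_const_nth fps_X_power_mult_nth using assms
      by (auto simp: quot_coeff_def binomial_gbinomial)
  qed
  have *: "?b ^ l * (?b ^ p - 1) ^ m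
      = fps_const (of_nat p ^ m) * (fps_X ^ m * (?b ^ l * (fps_X * ?u + 1) ^ m))"
    unfolding one_plus_X_power_minus_one[OF assms(1)]
    by (simp add: power_mult_distrib mult_ac add_ac flip: fps_of_nat fps_const_power)
  have "of_int (alt_binom_sum p l s m)
      = of_nat p ^ m * (?b ^ l * (fps_X * ?u + 1) ^ m) $ (s - 1)"
    unfolding of_int_alt_binom_sum * fps_mult_left_const_nth fps_X_power_mult_nth
    using assms by simp
  also have "(?b ^ l * (fps_X * ?u + 1) ^ m) $ (s - 1)
      = (\<Sum>j\<le>m. if j < s then quot_coeff p l s j * (of_nat m gchoose j) else 0)"
    using summand by (simp add: binomial_ring[of "fps_X * ?u"] sum_distrib_left fps_sum_nth)
  also have "\<dots> = (\<Sum>j<s. quot_coeff p l s j * (of_nat m gchoose j))"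
    \<comment> \<open>Indices with \<open>m < j < s\<close> contribute nothing because
      \<open>m choose j\<close> vanishes.\<close>
    by (intro sum.mono_neutral_cong) (auto simp: binomial_gbinomial[symmetric])
  finally show ?thesis .
qed

text \<open>For \<open>j > 0\<close> the index \<open>s - 1 - j\<close> lies below
  \<open>s - 1\<close>, so only coefficients of \<open>u\<close> below \<open>p - 2\<close> enter.
  For \<open>j = 0\<close> the series \<open>u\<close> is absent.\<close>

lemma quot_coeff_in_Ints:
  assumes "prime p" "s < p" "j < s"
  shows "quot_coeff p l s j \<in> \<int>"
proof (cases "j = 0")
  case True
  then show ?thesis by (simp add: quot_coeff_def fps_one_plus_X_power_nth)
next
  case False
  show ?thesis
    unfolding quot_coeff_def
  proof (rule fps_mult_nth_in_Ints[where n = "s - 1"])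
    show "(prime_quot_series p ^ j) $ k \<in> \<int>" if "k < s - 1" for k
      using assms that
      by (intro fps_power_nth_in_Ints[where n = "s - 1"] prime_quot_series_nth_in_Ints) auto
  qed (use False assms in \<open>auto simp: fps_one_plus_X_power_nth\<close>)
qed

text \<open>Here the index is \<open>0\<close>, so the value is the product of constant terms,
  \<open>((p - 1) / 2) ^ (s - 1)\<close>, and \<open>p > 1\<close>.\<close>

lemma quot_coeff_last_nonzero:
  assumes "0 < s" "s < p"
  shows "quot_coeff p l s (s - 1) \<noteq> 0"
  using assms
  by (simp add: quot_coeff_def fps_nth_power_0 prime_quot_series_nth_0)

theorem theorem6p1:
  fixes p l s :: nat
  assumes "prime p" and "0 < s" and "s < p"
  shows "(\<forall>m::nat. [alt_binom_sum p l s m = 0] (mod (int p ^ m))) \<and>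
         (\<exists>Q :: rat poly. Q \<noteq> 0 \<and> degree Q = s - 1 \<and>
            (\<forall>x::int. poly Q (of_int x) \<in> \<int>) \<and>
            (\<forall>m::nat. of_int (alt_binom_sum p l s m) = of_nat p ^ m * poly Q (of_nat m)))"
proof -
  define Q where "Q = (\<Sum>j<s. smult (quot_coeff p l s j) (gbinomial_poly j))"
  have poly_Q: "poly Q x = (\<Sum>j<s. quot_coeff p l s j * (x gchoose j))" for x
    by (simp add: Q_def poly_sum poly_gbinomial_poly)
  have eq: "of_int (alt_binom_sum p l s m) = of_nat p ^ m * poly Q (of_nat m)" for m
    using assms by (simp add: of_int_alt_binom_sum_expansion poly_Q)
  have Ints: "poly Q (of_int x) \<in> \<int>" for x
    unfolding poly_Q using assms
    by (intro Ints_sum Ints_mult gbinomial_of_int_in_Ints quot_coeff_in_Ints) auto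
  \<comment> \<open>Only the summand \<open>j = s - 1\<close> reaches degree \<open>s - 1\<close>,
    so the top coefficient cannot cancel.\<close>
  have "coeff (gbinomial_poly j :: rat poly) (s - 1) = 0" if "j < s - 1" for j
    using that by (intro coeff_eq_0) (simp add: degree_gbinomial_poly)
  then have "coeff Q (s - 1)
      = quot_coeff p l s (s - 1) * lead_coeff (gbinomial_poly (s - 1))"
    using assms(2) by (cases s) (simp_all add: Q_def coeff_sum degree_gbinomial_poly)
  moreover have "gbinomial_poly (s - 1) \<noteq> (0 :: rat poly)"
    by (simp add: gbinomial_poly_def)
  ultimately have coeff: "coeff Q (s - 1) \<noteq> 0"
    using quot_coeff_last_nonzero assms by simp
  have "degree Q \<le> s - 1"
    unfolding Q_def
    by (intro degree_sum_le) (auto intro!: order.trans[OF degree_smult_le] simp: degree_gbinomial_poly)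
  with coeff have degree: "degree Q = s - 1"
    by (simp add: le_degree le_antisym)
  have "[alt_binom_sum p l s m = 0] (mod (int p ^ m))" for m
  proof -
    \<comment> \<open>Integrality of \<open>Q\<close> at \<open>m\<close> supplies the integer
      cofactor of \<open>p ^ m\<close>.\<close>
    obtain z where "poly Q (of_nat m) = of_int z"
      using Ints[of "int m"] by (auto elim: Ints_cases)
    with eq[of m] have "(of_int (alt_binom_sum p l s m) :: rat) = of_int (int p ^ m * z)"
      by simp
    then have "alt_binom_sum p l s m = int p ^ m * z"
      by (simp only: of_int_eq_iff)
    then show ?thesis by (simp add: cong_0_iff)
  qed
  moreover have "Q \<noteq> 0"
    using coeff by auto
  ultimately show ?thesis
    using eq Ints degree by blast
qed

end
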